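(* Let $a,b\in\mathbb{C}$. The Lie algebra $\mathcal{W}(a,b)$ admits a nontrivial transposed $\delta$-Poisson structure $\cdot$: 1. if $b\notin\{-1,1\}$, then $\delta=\frac1{1-b}$ and there is a finite set $\{\mu_k\}_{k\in\mathbb{Z}}$ such that $$L_i\cdot L_j=\sum_{k\in\mathbb{Z}}\mu_k I_{i+j+k};$$ 2. if $b=1$, then $\delta=1$ and there is a finite set $\{\mu_k\}_{k\in\mathbb{Z}}$ such that $$L_i\cdot L_j=\sum_{k\in\mathbb{Z}}(i+j+k+\mu_k)I_{i+j+k};$$ 3. if $b=-1$, then $\delta=\frac12$ and there is a finite set $\{\nu_k,\mu_k\}_{k\in\mathbb{Z}}$ such that $$L_i\cdot L_j=\sum_{k\in\mathbb{Z}}\nu_k L_{i+j+k}+\sum_{k\in\mathbb{Z}}\mu_k I_{i+j+k},\qquad L_i\cdot I_j=\sum_{k\in\mathbb{Z}}\nu_k I_{i+j+k}.$$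
   Context: All algebras are over $\mathbb{C}$, and the $\mu_k,\nu_k$ are complex numbers. For $a,b\in\mathbb{C}$, $\mathcal{W}(a,b)$ is the Lie algebra with basis $\{L_i,I_i\}_{i\in\mathbb{Z}}$ and brackets $[L_i,L_j]=(i-j)L_{i+j}$, $[L_i,I_j]=-(j+bi+a)I_{i+j}$. In multiplication tables, products of basis elements that are neither listed nor obtained from listed ones by (anti)commutativity are zero. For fixed $\delta\in\mathbb{C}$, a transposed $\delta$-Poisson algebra $(\mathrm{P},\cdot,[\cdot,\cdot])$ consists of a commutative associative algebra $(\mathrm{P},\cdot)$ and a Lie algebra $(\mathrm{P},[\cdot,\cdot])$ on the same space satisfying $x\cdot[y,z]=\delta\big([x\cdot y,z]+[y,x\cdot z]\big)$ for all $x,y,z$. A Lie algebra $(\mathfrak{L},[\cdot,\cdot])$ has a nontrivial transposed $\delta$-Poisson structure $\cdot$ if $(\mathfrak{L},\cdot,[\cdot,\cdot])$ is a transposed $\delta$-Poisson algebra with both multiplications nonzero.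
   Formalization: For b=1 the printed form is shown only for existence; as a classification it is false (e.g. L_i·L_j=2(i+j+a)I_{i+j}), so every structure is shown to have δ=1 and L_i·L_j=Σμ_k(i+j+k+a)I_{i+j+k}, except when δ=0 and a is an integer, where nontrivial structures with δ=0 exist. *)

theory Defs
  imports Complex_Main "HOL-Library.Poly_Mapping"
begin

section \<open>Complex algebras\<close>

text \<open>Vector spaces are given by an explicit scalar multiplication \<open>s\<close> on an abelian group;
  \<^const>\<open>Vector_Spaces.linear\<close> includes the vector space axioms for \<open>s\<close>.\<close>

definition bilinear_product ::
    "(complex \<Rightarrow> 'v \<Rightarrow> 'v::ab_group_add) \<Rightarrow> ('v \<Rightarrow> 'v \<Rightarrow> 'v) \<Rightarrow> bool" where
  "bilinear_product s m \<longleftrightarrow>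
     (\<forall>x. Vector_Spaces.linear s s (\<lambda>y. m x y)) \<and> (\<forall>y. Vector_Spaces.linear s s (\<lambda>x. m x y))"

definition comm_assoc_algebra ::
    "(complex \<Rightarrow> 'v \<Rightarrow> 'v::ab_group_add) \<Rightarrow> ('v \<Rightarrow> 'v \<Rightarrow> 'v) \<Rightarrow> bool" where
  "comm_assoc_algebra s m \<longleftrightarrow> bilinear_product s m \<and>
     (\<forall>x y. m x y = m y x) \<and> (\<forall>x y z. m (m x y) z = m x (m y z))"

definition lie_algebra ::
    "(complex \<Rightarrow> 'v \<Rightarrow> 'v::ab_group_add) \<Rightarrow> ('v \<Rightarrow> 'v \<Rightarrow> 'v) \<Rightarrow> bool" where
  "lie_algebra s br \<longleftrightarrow> bilinear_product s br \<and>
     (\<forall>x. br x x = 0) \<and>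
     (\<forall>x y z. br x (br y z) + br y (br z x) + br z (br x y) = 0)"

definition transposed_poisson ::
    "(complex \<Rightarrow> 'v \<Rightarrow> 'v::ab_group_add) \<Rightarrow> complex \<Rightarrow>
      ('v \<Rightarrow> 'v \<Rightarrow> 'v) \<Rightarrow> ('v \<Rightarrow> 'v \<Rightarrow> 'v) \<Rightarrow> bool" where
  "transposed_poisson s \<delta> m br \<longleftrightarrow> comm_assoc_algebra s m \<and> lie_algebra s br \<and>
     (\<forall>x y z. m x (br y z) = s \<delta> (br (m x y) z + br y (m x z)))"

definition nontrivial_transposed_poisson ::
    "(complex \<Rightarrow> 'v \<Rightarrow> 'v::ab_group_add) \<Rightarrow> complex \<Rightarrow>
      ('v \<Rightarrow> 'v \<Rightarrow> 'v) \<Rightarrow> ('v \<Rightarrow> 'v \<Rightarrow> 'v) \<Rightarrow> bool" where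
  "nontrivial_transposed_poisson s \<delta> m br \<longleftrightarrow> transposed_poisson s \<delta> m br \<and>
     (\<exists>x y. m x y \<noteq> 0) \<and> (\<exists>x y. br x y \<noteq> 0)"

section \<open>The Lie algebras \<open>W(a,b)\<close>\<close>

text \<open>The underlying space consists of the finitely supported functions on the index set of the
  basis \<open>L\<^sub>i\<close>, \<open>I\<^sub>i\<close>. The constructors are the indices; the basis vectors are \<open>Lv i\<close> and \<open>Iv i\<close>.\<close>

datatype w_index = LI int | II int

type_synonym w_vec = "w_index \<Rightarrow>\<^sub>0 complex"

definition w_scale :: "complex \<Rightarrow> w_vec \<Rightarrow> w_vec" where
  "w_scale c v = Poly_Mapping.map ((*) c) v"

definition Lv :: "int \<Rightarrow> w_vec" where "Lv i = Poly_Mapping.single (LI i) 1"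

definition Iv :: "int \<Rightarrow> w_vec" where "Iv i = Poly_Mapping.single (II i) 1"

fun w_basis_bracket :: "complex \<Rightarrow> complex \<Rightarrow> w_index \<Rightarrow> w_index \<Rightarrow> w_vec" where
  "w_basis_bracket a b (LI i) (LI j) = w_scale (of_int (i - j)) (Lv (i + j))"
| "w_basis_bracket a b (LI i) (II j) = w_scale (- (of_int j + b * of_int i + a)) (Iv (i + j))"
| "w_basis_bracket a b (II i) (LI j) = w_scale (of_int i + b * of_int j + a) (Iv (i + j))"
| "w_basis_bracket a b (II i) (II j) = 0"

definition w_bracket :: "complex \<Rightarrow> complex \<Rightarrow> w_vec \<Rightarrow> w_vec \<Rightarrow> w_vec" where
  "w_bracket a b x y =
     (\<Sum>p\<in>Poly_Mapping.keys x. \<Sum>q\<in>Poly_Mapping.keys y.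
        w_scale (Poly_Mapping.lookup x p * Poly_Mapping.lookup y q) (w_basis_bracket a b p q))"

abbreviation w_transposed_poisson ::
    "complex \<Rightarrow> complex \<Rightarrow> complex \<Rightarrow> (w_vec \<Rightarrow> w_vec \<Rightarrow> w_vec) \<Rightarrow> bool" where
  "w_transposed_poisson a b \<delta> m \<equiv> nontrivial_transposed_poisson w_scale \<delta> m (w_bracket a b)"

subsection \<open>\<open>W(a,b)\<close> is a Lie algebra with the prescribed brackets\<close>

lemma lookup_w_scale [simp]: "Poly_Mapping.lookup (w_scale c v) p = c * Poly_Mapping.lookup v p"
  by (simp add: w_scale_def map.rep_eq when_def)

lemma vector_space_w_scale: "vector_space w_scale"
  by unfold_locales (auto intro!: poly_mapping_eqI simp: lookup_add algebra_simps)

interpretation w: vector_space w_scale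
  by (rule vector_space_w_scale)

lemma w_bracket_superset:
  assumes "finite A" "finite B" "Poly_Mapping.keys x \<subseteq> A" "Poly_Mapping.keys y \<subseteq> B"
  shows "w_bracket a b x y =
    (\<Sum>p\<in>A. \<Sum>q\<in>B.
        w_scale (Poly_Mapping.lookup x p * Poly_Mapping.lookup y q) (w_basis_bracket a b p q))"
proof -
  have "w_bracket a b x y =
      (\<Sum>p\<in>A. \<Sum>q\<in>Poly_Mapping.keys y.
        w_scale (Poly_Mapping.lookup x p * Poly_Mapping.lookup y q) (w_basis_bracket a b p q))"
    unfolding w_bracket_def
    by (rule sum.mono_neutral_left) (use assms in \<open>auto simp: in_keys_iff\<close>)
  also have "\<dots> = (\<Sum>p\<in>A. \<Sum>q\<in>B.
        w_scale (Poly_Mapping.lookup x p * Poly_Mapping.lookup y q) (w_basis_bracket a b p q))"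
    by (rule sum.cong, simp, rule sum.mono_neutral_left) (use assms in \<open>auto simp: in_keys_iff\<close>)
  finally show ?thesis .
qed

lemma keys_w_scale: "Poly_Mapping.keys (w_scale c v) \<subseteq> Poly_Mapping.keys v"
  by (auto simp: in_keys_iff)

lemma w_bracket_add_right: "w_bracket a b x (y + z) = w_bracket a b x y + w_bracket a b x z"
proof -
  let ?B = "Poly_Mapping.keys y \<union> Poly_Mapping.keys z"
  have "Poly_Mapping.keys (y + z) \<subseteq> ?B" by (rule keys_add)
  then show ?thesis
    by (simp add: w_bracket_superset[of "Poly_Mapping.keys x" ?B] lookup_add sum.distrib[symmetric]
        distrib_left w.scale_left_distrib)
qed

lemma w_bracket_scale_right: "w_bracket a b x (w_scale c y) = w_scale c (w_bracket a b x y)"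
  using keys_w_scale[of c y]
  by (simp add: w_bracket_superset[of "Poly_Mapping.keys x" "Poly_Mapping.keys y"]
      w.scale_sum_right mult.left_commute)

lemma w_basis_bracket_skew: "w_basis_bracket a b p q = - w_basis_bracket a b q p"
  by (cases p; cases q) (simp_all add: add.commute flip: w.scale_minus_left)

lemma w_bracket_skew: "w_bracket a b x y = - w_bracket a b y x"
proof -
  have "w_bracket a b x y =
      (\<Sum>q\<in>Poly_Mapping.keys y. \<Sum>p\<in>Poly_Mapping.keys x.
        w_scale (Poly_Mapping.lookup x p * Poly_Mapping.lookup y q) (w_basis_bracket a b p q))"
    unfolding w_bracket_def by (rule sum.swap)
  also have "\<dots> = - w_bracket a b y x"
    unfolding w_bracket_def sum_negf[symmetric]
    by (intro sum.cong refl) (subst w_basis_bracket_skew, simp add: mult.commute)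
  finally show ?thesis .
qed

lemma w_bracket_add_left: "w_bracket a b (x + y) z = w_bracket a b x z + w_bracket a b y z"
  by (metis w_bracket_skew w_bracket_add_right minus_add_distrib)

lemma w_bracket_scale_left: "w_bracket a b (w_scale c x) z = w_scale c (w_bracket a b x z)"
  by (metis w_bracket_skew w_bracket_scale_right w.scale_minus_right)

lemma bilinear_w_bracket: "bilinear_product w_scale (w_bracket a b)"
proof -
  have "Vector_Spaces.linear w_scale w_scale (w_bracket a b x)" for x
    unfolding Vector_Spaces.linear_iff
    by (simp add: vector_space_w_scale w_bracket_add_right w_bracket_scale_right)
  moreover have "Vector_Spaces.linear w_scale w_scale (\<lambda>x. w_bracket a b x y)" for y
    unfolding Vector_Spaces.linear_iff
    by (simp add: vector_space_w_scale w_bracket_add_left w_bracket_scale_left)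
  ultimately show ?thesis by (simp add: bilinear_product_def)
qed

lemma w_bracket_basis [simp]:
  "w_bracket a b (Lv i) (Lv j) = w_scale (of_int (i - j)) (Lv (i + j))"
  "w_bracket a b (Lv i) (Iv j) = w_scale (- (of_int j + b * of_int i + a)) (Iv (i + j))"
  "w_bracket a b (Iv i) (Lv j) = w_scale (of_int i + b * of_int j + a) (Iv (i + j))"
  "w_bracket a b (Iv i) (Iv j) = 0"
  by (simp_all add: w_bracket_def Lv_def Iv_def)

lemma w_vec_induct [consumes 0, case_names L I zero add scale]:
  assumes L: "\<And>i. P (Lv i)" and I: "\<And>i. P (Iv i)" and zero: "P 0"
    and add: "\<And>x y. P x \<Longrightarrow> P y \<Longrightarrow> P (x + y)"
    and scale: "\<And>c x. P x \<Longrightarrow> P (w_scale c x)"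
  shows "P x"
proof -
  have single: "P (w_scale c (Poly_Mapping.single p 1))" for c p
    using L I scale by (cases p) (auto simp: Lv_def Iv_def)
  have "P (\<Sum>p\<in>A. w_scale (Poly_Mapping.lookup x p) (Poly_Mapping.single p 1))" if "finite A" for A
    using that by induction (auto intro: zero add single)
  moreover have "x = (\<Sum>p\<in>Poly_Mapping.keys x.
      w_scale (Poly_Mapping.lookup x p) (Poly_Mapping.single p 1))"
    by (rule poly_mapping_eqI)
      (simp add: lookup_sum lookup_single when_def in_keys_iff if_distrib cong: if_cong)
  ultimately show ?thesis by (metis finite_keys)
qed

lemma lie_algebra_w_bracket: "lie_algebra w_scale (w_bracket a b)"
proof -
  let ?br = "w_bracket a b"
  have zero: "?br 0 z = 0" "?br z 0 = 0" for z
    by (simp_all add: w_bracket_def)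
  note bil = w_bracket_add_left w_bracket_scale_left zero w_bracket_add_right w_bracket_scale_right
  define J where "J x y z = ?br x (?br y z) + ?br y (?br z x) + ?br z (?br x y)" for x y z
  have J_bil: "J (x + x') y z = J x y z + J x' y z" "J (w_scale c x) y z = w_scale c (J x y z)"
    "J 0 y z = 0" for x x' y z c
    by (simp_all add: J_def bil algebra_simps w.scale_right_distrib)
  have J_cyc: "J x y z = J y z x" for x y z
    by (simp add: J_def)
  have J_ext: "J x y z = 0" if "\<And>i. J (Lv i) y z = 0" "\<And>i. J (Iv i) y z = 0" for x y z
    by (induction x rule: w_vec_induct) (simp_all add: that J_bil)
  have LLL: "J (Lv i) (Lv j) (Lv k) = 0" for i j k
    by (simp add: J_def bil add.left_commute add.commute flip: w.scale_left_distrib,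
        rule disjI1) (simp add: algebra_simps)
  have LLI: "J (Lv i) (Lv j) (Iv k) = 0" for i j k
    by (simp add: J_def bil add.left_commute add.commute flip: w.scale_left_distrib
          w.scale_minus_left,
        rule disjI1) (simp add: algebra_simps)
  have LII: "J (Lv i) (Iv j) (Iv k) = 0" and III: "J (Iv i) (Iv j) (Iv k) = 0" for i j k
    by (simp_all add: J_def bil)
  have basis: "J x y z = 0" if "x \<in> range Lv \<union> range Iv" "y \<in> range Lv \<union> range Iv"
      "z \<in> range Lv \<union> range Iv" for x y z
    using that LLL LLI LII III by (auto; metis J_cyc)
  have one: "J x y z = 0" if "y \<in> range Lv \<union> range Iv" "z \<in> range Lv \<union> range Iv" for x y z
    by (rule J_ext) (use that basis in auto)
  have two: "J x y z = 0" if "z \<in> range Lv \<union> range Iv" for x y z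
  proof -
    have *: "J v z x = 0" if "v \<in> range Lv \<union> range Iv" for v
      using one[where y = v and z = z and x = x] J_cyc[of x v z] that
        \<open>z \<in> range Lv \<union> range Iv\<close> by simp
    have "J y z x = 0" by (rule J_ext; rule *) auto
    then show ?thesis by (simp only: J_cyc[of x y z])
  qed
  have "J x y z = 0" for x y z
  proof (rule J_ext)
    show "J (Lv i) y z = 0" "J (Iv i) y z = 0" for i
      using two[where x = y and y = z and z = "Lv i"]
        two[where x = y and y = z and z = "Iv i"]
        J_cyc[of "Lv i" y z] J_cyc[of "Iv i" y z] by simp_all
  qed
  moreover have "?br x x = 0" for x
  proof (rule poly_mapping_eqI)
    fix p
    have "Poly_Mapping.lookup (?br x x) p = - Poly_Mapping.lookup (?br x x) p"
      by (metis w_bracket_skew lookup_uminus)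
    then show "Poly_Mapping.lookup (?br x x) p = Poly_Mapping.lookup 0 p" by simp
  qed
  ultimately show ?thesis
    by (simp add: lie_algebra_def bilinear_w_bracket J_def)
qed

end

theory Submission
  imports Defs
begin

text \<open>Commutativity of the product turns the defining identity into the cyclic identity
  \<open>x \<cdot> [y, z] + y \<cdot> [z, x] + z \<cdot> [x, y] = 0\<close>. It forces \<open>L\<^sub>i \<cdot> L\<^sub>j = F (i + j)\<close> with
  \<open>F n = L\<^sub>0 \<cdot> L\<^sub>n\<close>, so only the coefficients \<open>f k n\<close> of \<open>L\<^sub>n\<^sub>+\<^sub>k\<close> and \<open>g k n\<close> of \<open>I\<^sub>n\<^sub>+\<^sub>k\<close> in
  \<open>F n\<close> are unknown. For \<open>\<delta> \<noteq> 0\<close> the defining identity makes \<open>f k\<close> constant and \<open>g k\<close> affine: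
  \<open>f \<noteq> 0\<close> needs \<open>\<delta> = 1/2\<close> and \<open>b = -1\<close>, a nonconstant \<open>g k\<close> needs \<open>\<delta> = b = 1\<close>, and a nonzero
  constant one needs \<open>\<delta> (1 - b) = 1\<close>. The products \<open>L\<^sub>i \<cdot> I\<^sub>j\<close> are then determined by \<open>f\<close>, and
  \<open>I\<^sub>i \<cdot> I\<^sub>j = 0\<close>. The value \<open>\<delta> = 0\<close> is impossible when the Lie algebra is perfect, which fails only
  for \<open>b = 1\<close> and integral \<open>a\<close>.\<close>

section \<open>Coefficients of brackets\<close>

lemma lookup_Lv [simp]:
  "Poly_Mapping.lookup (Lv i) (LI n) = (if i = n then 1 else 0)"
  "Poly_Mapping.lookup (Lv i) (II n) = 0"
  by (simp_all add: Lv_def lookup_single when_def)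

lemma lookup_Iv [simp]:
  "Poly_Mapping.lookup (Iv i) (II n) = (if i = n then 1 else 0)"
  "Poly_Mapping.lookup (Iv i) (LI n) = 0"
  by (simp_all add: Iv_def lookup_single when_def)

lemma w_bracket_zero [simp]: "w_bracket a b 0 y = 0" "w_bracket a b x 0 = 0"
  by (simp_all add: w_bracket_def)

lemma w_vec_eqI:
  assumes "\<And>n. Poly_Mapping.lookup x (LI n) = Poly_Mapping.lookup y (LI n)"
    and "\<And>n. Poly_Mapping.lookup x (II n) = Poly_Mapping.lookup y (II n)"
  shows "x = y"
  by (rule poly_mapping_eqI) (metis assms w_index.exhaust)

lemma lookup_w_bracket_Lv_right:
  "Poly_Mapping.lookup (w_bracket a b x (Lv j)) (LI n) =
     (of_int n - 2 * of_int j) * Poly_Mapping.lookup x (LI (n - j))"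
  "Poly_Mapping.lookup (w_bracket a b x (Lv j)) (II n) =
     (of_int (n - j) + b * of_int j + a) * Poly_Mapping.lookup x (II (n - j))"
  by (induction x rule: w_vec_induct)
    (simp_all add: w_bracket_add_left w_bracket_scale_left lookup_add distrib_left, auto?)

lemma lookup_w_bracket_Iv_right:
  "Poly_Mapping.lookup (w_bracket a b x (Iv j)) (LI n) = 0"
  "Poly_Mapping.lookup (w_bracket a b x (Iv j)) (II n) =
     - (of_int j + b * of_int (n - j) + a) * Poly_Mapping.lookup x (LI (n - j))"
  by (induction x rule: w_vec_induct)
    (simp_all add: w_bracket_add_left w_bracket_scale_left lookup_add distrib_left, auto?)

lemma lookup_w_bracket_Lv_left:
  "Poly_Mapping.lookup (w_bracket a b (Lv j) x) (LI n) =
     (2 * of_int j - of_int n) * Poly_Mapping.lookup x (LI (n - j))"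
  "Poly_Mapping.lookup (w_bracket a b (Lv j) x) (II n) =
     - (of_int (n - j) + b * of_int j + a) * Poly_Mapping.lookup x (II (n - j))"
  by (subst w_bracket_skew, simp add: lookup_w_bracket_Lv_right algebra_simps)+

lemma lookup_w_bracket_Iv_left:
  "Poly_Mapping.lookup (w_bracket a b (Iv j) x) (LI n) = 0"
  "Poly_Mapping.lookup (w_bracket a b (Iv j) x) (II n) =
     (of_int j + b * of_int (n - j) + a) * Poly_Mapping.lookup x (LI (n - j))"
  by (subst w_bracket_skew, simp add: lookup_w_bracket_Iv_right algebra_simps)+

lemmas lookup_w_bracket_basis =
  lookup_w_bracket_Lv_left lookup_w_bracket_Lv_right
  lookup_w_bracket_Iv_left lookup_w_bracket_Iv_right

lemma lookup_sum_basis: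
  assumes "finite A" "\<And>k. k \<notin> A \<Longrightarrow> c k = 0"
  shows "Poly_Mapping.lookup (\<Sum>k\<in>A. w_scale (c k) (Lv (s + k))) (LI n) = c (n - s)"
    and "Poly_Mapping.lookup (\<Sum>k\<in>A. w_scale (c k) (Lv (s + k))) (II n) = 0"
    and "Poly_Mapping.lookup (\<Sum>k\<in>A. w_scale (c k) (Iv (s + k))) (LI n) = 0"
    and "Poly_Mapping.lookup (\<Sum>k\<in>A. w_scale (c k) (Iv (s + k))) (II n) = c (n - s)"
proof -
  have "(\<Sum>k\<in>A. c k * (if s + k = n then 1 else 0)) = (\<Sum>k\<in>A. if n - s = k then c k else 0)"
    by (rule sum.cong) auto
  also have "\<dots> = c (n - s)" using assms by auto
  finally show "Poly_Mapping.lookup (\<Sum>k\<in>A. w_scale (c k) (Lv (s + k))) (LI n) = c (n - s)"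
    "Poly_Mapping.lookup (\<Sum>k\<in>A. w_scale (c k) (Iv (s + k))) (II n) = c (n - s)"
    by (simp_all add: lookup_sum)
qed (simp_all add: lookup_sum)

lemma w_linear_eq_0:
  assumes "Vector_Spaces.linear w_scale w_scale f" "\<And>i. f (Lv i) = 0" "\<And>i. f (Iv i) = 0"
  shows "f x = 0"
proof -
  interpret f: Vector_Spaces.linear w_scale w_scale f by fact
  show ?thesis
    by (induction x rule: w_vec_induct) (simp_all add: assms f.add f.scale f.zero)
qed

section \<open>Consequences of the transposed Poisson identity\<close>

locale w_tpa =
  fixes a b \<delta> :: complex and m :: "w_vec \<Rightarrow> w_vec \<Rightarrow> w_vec"
  assumes transposed: "transposed_poisson w_scale \<delta> m (w_bracket a b)"
begin

lemma m_comm: "m x y = m y x"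
  using transposed by (simp add: transposed_poisson_def comm_assoc_algebra_def)

lemma m_linear: "Vector_Spaces.linear w_scale w_scale (m x)"
  using transposed
  by (simp add: transposed_poisson_def comm_assoc_algebra_def bilinear_product_def)

lemma m_scale_right [simp]: "m x (w_scale c y) = w_scale c (m x y)"
  using m_linear by (simp add: Vector_Spaces.linear_iff)

lemma m_minus_right [simp]: "m x (- y) = - m x y"
  using m_scale_right[of x "- 1" y] by (simp only: w.scale_minus_left w.scale_one)

lemma m_add_right [simp]: "m x (y + z) = m x y + m x z"
  using m_linear by (simp add: Vector_Spaces.linear_iff)

lemma m_diff_right [simp]: "m x (y - z) = m x y - m x z"
  using m_add_right[of x y "- z"] by simp

lemma m_zero_right [simp]: "m x 0 = 0"
  using m_scale_right[of x 0 0] by simp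

lemma m_bracket:
  "m x (w_bracket a b y z) = w_scale \<delta> (w_bracket a b (m x y) z + w_bracket a b y (m x z))"
  using transposed by (simp add: transposed_poisson_def)

text \<open>Expanding the three products by \<open>m_bracket\<close> yields six brackets, which
  cancel in pairs by commutativity of \<open>m\<close> and skew symmetry.\<close>

lemma m_bracket_cyclic:
  "m x (w_bracket a b y z) + m y (w_bracket a b z x) + m z (w_bracket a b x y) = 0"
proof -
  have "w_bracket a b (m x y) z = - w_bracket a b z (m y x)"
    "w_bracket a b (m y z) x = - w_bracket a b x (m z y)"
    "w_bracket a b (m z x) y = - w_bracket a b y (m x z)"
    by (metis m_comm w_bracket_skew)+
  then show ?thesis
    unfolding m_bracket by (simp flip: w.scale_right_distrib)
qed

text \<open>The cyclic identity at \<open>L\<^sub>i, L\<^sub>j, L\<^sub>0\<close> gives the claim for \<open>i \<noteq> j\<close>, and then at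
  \<open>L\<^sub>i, L\<^sub>q, L\<^sub>i\<^sub>-\<^sub>q\<close> for \<open>i = j\<close>.\<close>

lemma m_Lv_Lv: "m (Lv i) (Lv j) = m (Lv 0) (Lv (i + j))"
proof -
  have ne: "m (Lv i) (Lv j) = m (Lv 0) (Lv (i + j))" if "i \<noteq> j" for i j
  proof -
    have "w_scale (of_int (j - i)) (m (Lv i) (Lv j) - m (Lv 0) (Lv (i + j))) = 0"
      using m_bracket_cyclic[of "Lv i" "Lv j" "Lv 0"] m_comm[of "Lv j" "Lv i"]
      by (simp add: algebra_simps)
    with that show ?thesis by simp
  qed
  show ?thesis
  proof (cases "i = j")
    case True
    \<comment> \<open>Excluding \<open>i\<close> and \<open>0\<close> makes the index pairs
      \<open>q, 2 * i - q\<close> and \<open>i - q, i + q\<close> unequal, so that \<open>ne\<close>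
      applies; \<open>2 * q \<noteq> i\<close> keeps the coefficient of the square nonzero.\<close>
    obtain q :: int where q: "q \<noteq> 0" "q \<noteq> i" "2 * q \<noteq> i"
    proof -
      have "infinite (UNIV - {0, i, i div 2})" by simp
      then obtain q where "q \<in> UNIV - {0, i, i div 2}" by (metis finite.emptyI ex_in_conv)
      with that show ?thesis by fastforce
    qed
    have "w_scale (of_int (2 * q - i)) (m (Lv i) (Lv i))
      + w_scale (of_int (- q)) (m (Lv q) (Lv (2 * i - q)))
      + w_scale (of_int (i - q)) (m (Lv (i - q)) (Lv (i + q))) = 0"
      using m_bracket_cyclic[of "Lv i" "Lv q" "Lv (i - q)"] by (simp add: algebra_simps)
    moreover have "m (Lv q) (Lv (2 * i - q)) = m (Lv 0) (Lv (2 * i))"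
      "m (Lv (i - q)) (Lv (i + q)) = m (Lv 0) (Lv (2 * i))"
      using ne[of q "2 * i - q"] ne[of "i - q" "i + q"] q by (simp_all add: algebra_simps)
    ultimately have "w_scale (of_int (2 * q - i)) (m (Lv i) (Lv i))
      + w_scale (of_int (- q) + of_int (i - q)) (m (Lv 0) (Lv (2 * i))) = 0"
      by (simp only: w.scale_left_distrib add.assoc)
    moreover have "of_int (- q) + of_int (i - q) = - (of_int (2 * q - i) :: complex)"
      by simp
    ultimately have "w_scale (of_int (2 * q - i)) (m (Lv i) (Lv i) - m (Lv 0) (Lv (2 * i))) = 0"
      by (simp only: w.scale_minus_left w.scale_right_diff_distrib) simp
    with q have "m (Lv i) (Lv i) = m (Lv 0) (Lv (2 * i))"
      by (metis eq_iff_diff_eq_0 of_int_eq_0_iff w.scale_eq_0_iff)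
    with True show ?thesis by simp
  qed (rule ne)
qed

text \<open>Indexing by the shift \<open>k\<close> instead of the target degree decouples the
  relations: \<open>f_eq\<close> and \<open>g_eq\<close> each involve a single
  \<open>k\<close>.\<close>

definition f :: "int \<Rightarrow> int \<Rightarrow> complex" where
  "f k n = Poly_Mapping.lookup (m (Lv 0) (Lv n)) (LI (n + k))"

definition g :: "int \<Rightarrow> int \<Rightarrow> complex" where
  "g k n = Poly_Mapping.lookup (m (Lv 0) (Lv n)) (II (n + k))"

lemma lookup_m_Lv_Lv:
  "Poly_Mapping.lookup (m (Lv i) (Lv j)) (LI n) = f (n - i - j) (i + j)"
  "Poly_Mapping.lookup (m (Lv i) (Lv j)) (II n) = g (n - i - j) (i + j)"
  by (simp_all add: m_Lv_Lv[of i j] f_def g_def)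

text \<open>The indices \<open>p\<close>, \<open>u - p\<close>, \<open>v - p\<close> are chosen so
  that the two products on the right are \<open>L_0 \<cdot> L_u\<close> and
  \<open>L_0 \<cdot> L_v\<close>, with \<open>p\<close> still free. The same holds for
  \<open>g_eq\<close>.\<close>

lemma f_eq:
  "of_int (u - v) * f k (u + v - p) =
     \<delta> * (of_int (u - v + p + k) * f k u + of_int (u - v - p - k) * f k v)"
  using arg_cong[OF m_bracket[of "Lv p" "Lv (u - p)" "Lv (v - p)"],
      of "\<lambda>x. Poly_Mapping.lookup x (LI (u + v - p + k))"]
  by (simp add: lookup_w_bracket_basis lookup_m_Lv_Lv lookup_add) (simp add: algebra_simps)

lemma g_eq:
  "of_int (u - v) * g k (u + v - p) =
     \<delta> * ((of_int (u + k) + a + b * of_int (v - p)) * g k u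
        - (of_int (v + k) + a + b * of_int (u - p)) * g k v)"
  using arg_cong[OF m_bracket[of "Lv p" "Lv (u - p)" "Lv (v - p)"],
      of "\<lambda>x. Poly_Mapping.lookup x (II (u + v - p + k))"]
  by (simp add: lookup_w_bracket_basis lookup_m_Lv_Lv lookup_add) (simp add: algebra_simps)

text \<open>For \<delta> = 0 every product with a bracket vanishes, and each basis vector is a
  nonzero multiple of a bracket.\<close>

lemma m_eq_0_if_perfect:
  assumes "\<delta> = 0" "b \<noteq> 1 \<or> a \<notin> \<int>"
  shows "m x y = 0"
proof (rule w_linear_eq_0[OF m_linear])
  have zero: "m x (w_bracket a b y z) = 0" for y z
    by (simp add: m_bracket assms)
  show "m x (Lv n) = 0" for n
  proof -
    obtain i :: int where "2 * i \<noteq> n"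
      by (metis mult_cancel_left zero_neq_numeral zero_neq_one)
    then show ?thesis
      using zero[of "Lv i" "Lv (n - i)"] by simp (metis of_int_eq_iff of_int_mult of_int_numeral)
  qed
  show "m x (Iv n) = 0" for n
  proof -
    have "\<exists>i. of_int (n - i) + b * of_int i + a \<noteq> 0"
    proof (rule ccontr)
      assume *: "\<not> ?thesis"
      \<comment> \<open>The cases \<open>i = 0\<close> and \<open>i = 1\<close> already force
        \<open>b = 1\<close> and \<open>a = - n\<close>, the excluded situation.\<close>
      have "of_int n + a = 0" "of_int n - 1 + b + a = 0"
        using *[simplified, rule_format, of 0] *[simplified, rule_format, of 1] by simp_all
      moreover from this have "a = of_int (- n)"
        by (simp add: eq_neg_iff_add_eq_0 add.commute)
      ultimately show False
        using assms(2) by auto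
    qed
    then obtain i where "of_int (n - i) + b * of_int i + a \<noteq> 0" ..
    moreover have "w_scale (of_int (n - i) + b * of_int i + a) (m x (Iv n)) = 0"
      using zero[of "Iv (n - i)" "Lv i"] by simp
    ultimately show ?thesis by simp
  qed
qed

end

section \<open>The coefficients of \<open>L_i \<cdot> L_j\<close> for nonzero \<delta>\<close>

locale w_tpa_nz = w_tpa +
  assumes delta_nz: "\<delta> \<noteq> 0"
begin

text \<open>Setting \<open>p\<close> equal to the second index makes the value on the left coincide
  with one on the right, which leaves a relation between two values. The offset \<open>- k\<close>
  removes \<open>k\<close> from the coefficients.\<close>

lemma f_shift:
  "(of_int u * (1 - \<delta>) - of_int v) * f k (u - k) = \<delta> * of_int (u - 2 * v) * f k (v - k)"
  using f_eq[of "u - k" "v - k" k "v - k"] by (simp add: algebra_simps)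

lemma f_const: "f k n = f k 0"
  and f_nonzero: "f k n \<noteq> 0 \<Longrightarrow> \<delta> = 1 / 2"
proof -
  have F0: "f k (- k) = 2 * \<delta> * f k (v - k)" if "v \<noteq> 0" for v
    using f_shift[of 0 v k] that by (simp add: field_simps)
  \<comment> \<open>By \<open>F0\<close> the values at \<open>1 - k\<close> and \<open>2 - k\<close>
    agree, while \<open>f_shift\<close> relates them with coefficients \<open>- 1 - \<delta>\<close>
    and \<open>- 3 * \<delta>\<close>.\<close>
  have F1: "f k (1 - k) * (2 * \<delta> - 1) = 0"
    using f_shift[of 1 2 k] F0[of 1] F0[of 2] delta_nz by (simp add: algebra_simps)
  have "(f k (v - k) = 0 \<and> f k (- k) = 0) \<or> (\<delta> = 1 / 2 \<and> f k (v - k) = f k (- k))" for v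
    using F1 F0[of 1] F0[of v] delta_nz by (cases "v = 0") (auto simp: field_simps)
  then have *: "(f k n = 0 \<and> f k (- k) = 0) \<or> (\<delta> = 1 / 2 \<and> f k n = f k (- k))" for n
    by (metis diff_add_cancel add_diff_cancel_right')
  show "f k n = f k 0" using *[of n] *[of 0] by auto
  show "f k n \<noteq> 0 \<Longrightarrow> \<delta> = 1 / 2" using *[of n] by auto
qed

text \<open>With \<open>u = 1\<close>, \<open>v = 0\<close>, \<open>p = 1 - n\<close> the left side
  of \<open>g_eq\<close> is \<open>g k n\<close>, and the right side is affine in \<open>n\<close>
  with slope \<open>\<delta> * b * (g k 1 - g k 0)\<close>.\<close>

lemma g_step: "g k 1 - g k 0 = \<delta> * b * (g k 1 - g k 0)"
  and g_affine: "g k n = g k 0 + of_int n * (g k 1 - g k 0)"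
proof -
  have *: "g k n = \<delta> * ((1 + of_int k + a + b * of_int (n - 1)) * g k 1
      - (of_int k + a + b * of_int n) * g k 0)" for n
    using g_eq[of 1 0 k "1 - n"] by (simp add: algebra_simps)
  show step: "g k 1 - g k 0 = \<delta> * b * (g k 1 - g k 0)"
    using *[of 1] *[of 0] by simp algebra
  have "g k n - g k 0 = of_int n * (\<delta> * b * (g k 1 - g k 0))"
    using *[of n] *[of 0] by simp algebra
  then show "g k n = g k 0 + of_int n * (g k 1 - g k 0)"
    using step by algebra
qed

text \<open>The instances \<open>u = 1\<close> and \<open>u = 2\<close> with
  \<open>v = p = 0\<close> differ by \<open>d = \<delta> * d\<close> for the slope \<open>d\<close>;
  then \<open>g_step\<close> gives \<open>b\<close>, and the first instance gives the constant
  term.\<close>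

lemma g_slope:
  assumes "g k 1 \<noteq> g k 0"
  shows "\<delta> = 1" "b = 1" "g k 0 = (of_int k + a) * (g k 1 - g k 0)"
proof -
  define d where "d = g k 1 - g k 0"
  have d: "d \<noteq> 0" using assms by (simp add: d_def)
  have g: "g k n = g k 0 + of_int n * d" for n using g_affine[of k n] by (simp add: d_def)
  have 1: "g k 0 + d = \<delta> * ((1 - b) * g k 0 + d + d * (of_int k + a))"
    using g_eq[of 1 0 k 0] g[of 1] by (simp add: algebra_simps)
  have 2: "g k 0 + 2 * d = \<delta> * ((1 - b) * g k 0 + 2 * d + d * (of_int k + a))"
    using g_eq[of 2 0 k 0] g[of 2] by simp algebra
  have "d = \<delta> * d" using 1 2 by algebra
  with d show \<delta>: "\<delta> = 1" by simp
  show b: "b = 1" using g_step[of k] d \<delta> by (simp add: d_def)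
  show "g k 0 = (of_int k + a) * (g k 1 - g k 0)"
    using 1 \<delta> b by (simp add: d_def algebra_simps)
qed

lemma g_constant_nonzero:
  assumes "g k 1 = g k 0" "g k 0 \<noteq> 0"
  shows "\<delta> * (1 - b) = 1"
proof -
  have "(\<delta> * (1 - b) - 1) * g k 0 = 0"
    using g_eq[of 1 0 k 0] assms(1) by (simp add: algebra_simps)
  with assms(2) show ?thesis by simp
qed

section \<open>The products \<open>L_p \<cdot> I_j\<close>\<close>

definition \<alpha> :: "int \<Rightarrow> int \<Rightarrow> int \<Rightarrow> complex" where
  "\<alpha> p j n = Poly_Mapping.lookup (m (Lv p) (Iv j)) (LI n)"

definition \<epsilon> :: "int \<Rightarrow> int \<Rightarrow> int \<Rightarrow> complex" where
  "\<epsilon> p j n = Poly_Mapping.lookup (m (Lv p) (Iv j)) (II n)"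

lemma lookup_m_Lv_Iv:
  "Poly_Mapping.lookup (m (Lv p) (Iv j)) (LI n) = \<alpha> p j n"
  "Poly_Mapping.lookup (m (Lv p) (Iv j)) (II n) = \<epsilon> p j n"
  "Poly_Mapping.lookup (m (Iv j) (Lv p)) (LI n) = \<alpha> p j n"
  "Poly_Mapping.lookup (m (Iv j) (Lv p)) (II n) = \<epsilon> p j n"
  by (simp_all add: \<alpha>_def \<epsilon>_def m_comm[of "Iv j"])

text \<open>Bracketing with \<open>L\<^sub>0\<close> shows that for fixed \<open>j\<close> at most one degree \<open>n\<close> can occur;
  comparing with a shifted degree then kills it. The proof of \<open>\<epsilon>_eq\<close> repeats this argument.\<close>

lemma \<alpha>_eq_0: "\<alpha> p j n = 0"
proof (rule ccontr)
  assume nz: "\<alpha> p j n \<noteq> 0"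
  have "(of_int j + a - \<delta> * of_int n') * \<alpha> p' j n' = 0" for p' n'
    using arg_cong[OF m_bracket[of "Lv p'" "Lv 0" "Iv j"],
        of "\<lambda>x. Poly_Mapping.lookup x (LI n')"]
    by (simp add: lookup_w_bracket_basis lookup_m_Lv_Lv lookup_m_Lv_Iv lookup_add) algebra
  then have supp: "of_int j + a = \<delta> * of_int n'" if "\<alpha> p' j n' \<noteq> 0" for p' n'
    using that by (metis mult_eq_0_iff right_minus_eq)
  have uniq: "n' = n" if "\<alpha> p' j n' \<noteq> 0" for p' n'
    using supp[OF that] supp[OF nz] delta_nz by simp
  \<comment> \<open>Avoiding \<open>0\<close> and \<open>p\<close> moves the degrees
    \<open>n + i\<close> and \<open>n + i - p\<close> away from \<open>n\<close>; avoiding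
    \<open>n\<close> keeps the surviving coefficient \<open>n - i\<close> nonzero.\<close>
  obtain i where i: "i \<notin> {0, p, n}"
    using ex_new_if_finite[OF infinite_UNIV_int, of "{0, p, n}"] by auto
  have "\<alpha> (p + i) j (n + i) = 0" "\<alpha> i j (n + i - p) = 0"
    using uniq[of "p + i" "n + i"] uniq[of i "n + i - p"] i by auto
  then have "of_int (n - i) * \<alpha> p j n = 0"
    using arg_cong[OF m_bracket[of "Iv j" "Lv p" "Lv i"],
        of "\<lambda>x. Poly_Mapping.lookup x (LI (n + i))"] delta_nz
    by (simp add: lookup_w_bracket_basis lookup_m_Lv_Iv lookup_add)
  with nz i show False by simp
qed

text \<open>The term in \<open>f\<close> comes from bracketing the \<open>L\<close>-part of
  \<open>L_p \<cdot> L_i\<close> with \<open>I_j\<close>; it makes this recursion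
  inhomogeneous.\<close>

lemma \<epsilon>_LLI:
  "- (of_int j + b * of_int i + a) * \<epsilon> p (i + j) n =
     \<delta> * (- (of_int j + b * of_int (n - j) + a) * f (n - p - i - j) 0
        - (of_int (n - i) + b * of_int i + a) * \<epsilon> p j (n - i))"
  using arg_cong[OF m_bracket[of "Lv p" "Lv i" "Iv j"],
      of "\<lambda>x. Poly_Mapping.lookup x (II n)"] f_const[of "n - j - p - i" "p + i"]
  by (simp add: lookup_w_bracket_basis lookup_m_Lv_Lv lookup_m_Lv_Iv lookup_add)
    (simp add: algebra_simps)

lemma \<epsilon>_ILL:
  "of_int (p - i) * \<epsilon> (p + i) j n =
     \<delta> * ((of_int (n - i) + b * of_int i + a) * \<epsilon> p j (n - i)
        - (of_int (n - p) + b * of_int p + a) * \<epsilon> i j (n - p))"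
  using arg_cong[OF m_bracket[of "Iv j" "Lv p" "Lv i"],
      of "\<lambda>x. Poly_Mapping.lookup x (II n)"]
  by (simp add: lookup_w_bracket_basis lookup_m_Lv_Iv lookup_add) (simp add: algebra_simps)

lemma f_nonzero_b:
  assumes nz: "f k n \<noteq> 0"
  shows "b = - 1"
proof (rule ccontr)
  assume b: "b \<noteq> - 1"
  have \<delta>: "\<delta> = 1 / 2" using f_nonzero nz .
  define \<phi> where "\<phi> = f k 0"
  have \<phi>: "\<phi> \<noteq> 0" using nz f_const[of k n] by (simp add: \<phi>_def)
  \<comment> \<open>Here \<open>p = 1 - k\<close>, so that \<open>L_p \<cdot> I_j\<close> is read
    off at total shift \<open>p + k = 1\<close>. At shift \<open>0\<close> the relation
    \<open>E\<close> would not contain \<open>b\<close>.\<close>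
  define E where "E j = \<epsilon> (1 - k) j (j + 1)" for j
  have E: "(of_int j + a - 1) * E j = (of_int j + a + b) * \<phi>" for j
    using \<epsilon>_LLI[of j 0 "1 - k" "j + 1"]
    by (simp add: E_def \<phi>_def \<delta>) (simp add: field_simps)
  \<comment> \<open>Eliminating \<open>E j\<close> and \<open>E (i + j)\<close> from three linear
    relations leaves a polynomial condition on \<open>a\<close> and \<open>b\<close>.\<close>
  have key: "\<phi> * of_int i * (b + 1) * ((of_int j + a) * (b - 2) - b * (of_int i + 1)) = 0" for i j
  proof -
    let ?J = "of_int j + a"
    have "2 * (?J + b * of_int i) * E (i + j) =
        (?J + b * (1 + of_int i)) * \<phi> + (1 + ?J + b * of_int i) * E j"
      using \<epsilon>_LLI[of j i "1 - k" "i + j + 1"]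
      by (simp add: E_def \<phi>_def \<delta>) (simp add: field_simps)
    moreover have "(?J - 1) * E j = (?J + b) * \<phi>"
      "(?J + of_int i - 1) * E (i + j) = (?J + of_int i + b) * \<phi>"
      using E[of j] E[of "i + j"] by (simp_all add: algebra_simps)
    ultimately show ?thesis by algebra
  qed
  \<comment> \<open>Varying \<open>i\<close> gives \<open>b = 0\<close>; varying \<open>j\<close>
    then makes \<open>j + a\<close> vanish at both \<open>j = 0\<close> and
    \<open>j = 1\<close>.\<close>
  have "b = 0"
    using key[of 1 0] key[of 2 0] \<phi> b by (simp add: add_eq_0_iff2) 
  with key[of 1 0] key[of 1 1] \<phi> show False by simp
qed

text \<open>A nonzero \<open>f\<close> coefficient forces \<delta> = 1/2 and \<open>b = - 1\<close>,
  and in that case \<open>f\<close> itself solves both recursions. The difference \<open>e\<close>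
  therefore satisfies homogeneous ones, and the support argument leaves only \<open>b = 0\<close>,
  \<open>j = n = - a\<close>.\<close>

lemma \<epsilon>_eq: "\<epsilon> p j n = f (n - p - j) 0"
proof -
  define e where "e p j n = \<epsilon> p j n - f (n - p - j) 0" for p j n
  have LLI: "(of_int j + b * of_int i + a) * e p (i + j) n =
      \<delta> * (of_int (n - i) + b * of_int i + a) * e p j (n - i)" for p i j n
  proof -
    have hom: "(of_int j + b * of_int i + a) * f (n - p - i - j) 0 =
        \<delta> * (of_int j + b * of_int (n - j) + a) * f (n - p - i - j) 0
          + \<delta> * (of_int (n - i) + b * of_int i + a) * f (n - p - i - j) 0"
    proof (cases "f (n - p - i - j) 0 = 0")
      case False
      have \<delta>: "\<delta> = 1 / 2" by (rule f_nonzero[OF False])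
      have b: "b = - 1" by (rule f_nonzero_b[OF False])
      show ?thesis unfolding \<delta> b by (simp add: field_simps)
    qed simp
    have "(of_int j + b * of_int i + a) * e p (i + j) n =
        - (- (of_int j + b * of_int i + a) * \<epsilon> p (i + j) n)
          - (of_int j + b * of_int i + a) * f (n - p - i - j) 0"
      by (simp add: e_def algebra_simps)
    then show ?thesis
      unfolding \<epsilon>_LLI hom by (simp add: e_def algebra_simps)
  qed
  have ILL: "of_int (p - i) * e (p + i) j n =
      \<delta> * ((of_int (n - i) + b * of_int i + a) * e p j (n - i)
        - (of_int (n - p) + b * of_int p + a) * e i j (n - p))" for p i j n
  proof -
    have hom: "of_int (p - i) * f (n - p - i - j) 0 =
        \<delta> * ((of_int (n - i) + b * of_int i + a) * f (n - p - i - j) 0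
          - (of_int (n - p) + b * of_int p + a) * f (n - p - i - j) 0)"
    proof (cases "f (n - p - i - j) 0 = 0")
      case False
      have \<delta>: "\<delta> = 1 / 2" by (rule f_nonzero[OF False])
      have b: "b = - 1" by (rule f_nonzero_b[OF False])
      show ?thesis unfolding \<delta> b by (simp add: field_simps)
    qed simp
    have "of_int (p - i) * e (p + i) j n =
        of_int (p - i) * \<epsilon> (p + i) j n - of_int (p - i) * f (n - p - i - j) 0"
      by (simp add: e_def algebra_simps)
    then show ?thesis
      unfolding \<epsilon>_ILL hom by (simp add: e_def algebra_simps)
  qed
  have supp: "of_int j + a = \<delta> * (of_int n + a)" if "e p j n \<noteq> 0" for p j n
    using LLI[of j 0 p n] that by simp
  have special: "b = 0 \<and> of_int n + a = 0 \<and> j = n" if nz: "e p j n \<noteq> 0" for p j n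
  proof -
    have uniq: "n' = n" if "e p' j n' \<noteq> 0" for p' n'
      using supp[OF that] supp[OF nz] delta_nz by simp
    have 0: "of_int n + a + b * of_int i = 0" if "i \<noteq> 0" "i \<noteq> p" for i
    proof -
      have "e (p + i) j (n + i) = 0" "e i j (n + i - p) = 0"
        using uniq[of "p + i" "n + i"] uniq[of i "n + i - p"] that by auto
      then have "\<delta> * (of_int n + a + b * of_int i) * e p j n = 0"
        using ILL[of p i j "n + i"] by (simp add: algebra_simps)
      then show ?thesis using nz delta_nz by simp
    qed
    obtain i where i: "i \<notin> {0, p}"
      using ex_new_if_finite[OF infinite_UNIV_int, of "{0, p}"] by auto
    obtain i' where i': "i' \<notin> {0, p, i}"
      using ex_new_if_finite[OF infinite_UNIV_int, of "{0, p, i}"] by auto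
    have "b * of_int (i - i') = (of_int n + a + b * of_int i) - (of_int n + a + b * of_int i')"
      by (simp add: algebra_simps)
    also have "\<dots> = 0 - 0" by (rule arg_cong2[where f = minus]; rule 0) (use i i' in auto)
    finally have b: "b = 0" using i' by simp
    have n: "of_int n + a = 0" using 0[of i] i b by simp
    have "of_int j + a = 0" using supp[OF nz] n by simp
    with n have "of_int j = (of_int n :: complex)" by (metis add_right_cancel)
    with b n show ?thesis by simp
  qed
  have "e p j n = 0"
  proof (rule ccontr)
    assume nz: "e p j n \<noteq> 0"
    \<comment> \<open>The exceptional case is reached from \<open>j - 1\<close> by
      \<open>LLI\<close> with \<open>i = 1\<close>: \<open>e p (j - 1) (n - 1)\<close> vanishes by
      \<open>special\<close>, and the coefficient of \<open>e p j n\<close> is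
      \<open>- 1\<close>.\<close>
    have "of_int (n - 1) + a = of_int n + a - 1" by simp
    also have "\<dots> = - 1" using special[OF nz] by simp
    finally have ne: "of_int (n - 1) + a = - 1" .
    then have "e p (j - 1) (n - 1) = 0"
      by (metis special zero_neq_neg_one)
    then have "(of_int (j - 1) + b + a) * e p j n = 0"
      using LLI[of "j - 1" 1 p n] by simp
    moreover have "of_int (j - 1) + b + a = - 1"
      using special[OF nz] ne by (simp only:) simp
    ultimately show False using nz by simp
  qed
  then show ?thesis by (simp add: e_def)
qed

lemma m_Lv_Iv_eq_0:
  assumes "b \<noteq> - 1"
  shows "m (Lv i) (Iv j) = 0"
proof (rule w_vec_eqI)
  have "f k 0 = 0" for k
    using f_nonzero_b assms by blast
  then show "Poly_Mapping.lookup (m (Lv i) (Iv j)) (II n) = Poly_Mapping.lookup 0 (II n)" for n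
    by (simp add: lookup_m_Lv_Iv \<epsilon>_eq)
qed (simp add: lookup_m_Lv_Iv \<alpha>_eq_0)

text \<open>Unequal indices follow from the cyclic identity with \<open>L_0\<close>. A nonzero
  square would force \<open>b = 1\<close> and \<open>a = - i\<close>, and would then commute with
  every \<open>L_q\<close> for \<open>q \<noteq> 0\<close>, which only the zero vector does.\<close>

lemma m_Iv_Iv: "m (Iv i) (Iv j) = 0"
proof -
  have ne: "m (Iv i) (Iv j) = 0" if "i \<noteq> j" for i j
  proof -
    have "w_scale (of_int (i - j)) (m (Iv i) (Iv j)) = 0"
      using m_bracket_cyclic[of "Iv i" "Lv 0" "Iv j"] m_comm[of "Iv j" "Iv i"]
      by (simp add: algebra_simps)
    with that show ?thesis by simp
  qed
  have eq: "m (Iv i) (Iv i) = 0" for i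
  proof (rule ccontr)
    assume nz: "m (Iv i) (Iv i) \<noteq> 0"
    \<comment> \<open>In the cyclic identity at \<open>I_i\<close>, \<open>L_q\<close>,
      \<open>I_(i-q)\<close> the other product has the unequal indices \<open>i - q\<close>,
      \<open>i + q\<close> and vanishes.\<close>
    have *: "of_int (i - q) + b * of_int q + a = 0" if "q \<noteq> 0" for q
      using m_bracket_cyclic[of "Iv i" "Lv q" "Iv (i - q)"] ne[of "i - q" "i + q"] ne[of "i - q" i] that nz
      by simp (simp add: algebra_simps)
    have 12: "of_int i - 1 + b + a = 0" "of_int i - 2 + b * 2 + a = 0"
      using *[of 1] *[of 2] by simp_all
    have b: "b = 1" using 12 by algebra
    have i: "of_int i + a = 0" using 12 by algebra
    define v where "v = m (Iv i) (Iv i)"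
    have v: "w_bracket a b (Lv q) v = 0" if "q \<noteq> 0" for q
    proof -
      have "m (Iv i) (w_bracket a b (Lv q) (Iv i)) = 0"
        using that by (simp add: ne)
      moreover have "m (Iv i) (Lv q) = 0"
        unfolding m_comm[of "Iv i"] by (rule m_Lv_Iv_eq_0) (simp add: b)
      ultimately have "w_scale \<delta> (w_bracket a b (Lv q) v) = 0"
        unfolding m_bracket v_def by (simp only: w_bracket_zero add_0)
      then show ?thesis using delta_nz by simp
    qed
    have "v = 0"
    proof (rule w_vec_eqI)
      fix n :: int
      obtain q where q: "q \<notin> {0, n}"
        using ex_new_if_finite[OF infinite_UNIV_int, of "{0, n}"] by auto
      show "Poly_Mapping.lookup v (LI n) = Poly_Mapping.lookup 0 (LI n)"
        using arg_cong[OF v[of q], of "\<lambda>x. Poly_Mapping.lookup x (LI (n + q))"] q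
        by (simp add: lookup_w_bracket_basis)
      \<comment> \<open>As \<open>a = - i\<close> and \<open>b = 1\<close>, the coefficient
        \<open>n + q + a\<close> equals \<open>n + q - i\<close>, nonzero for this
        \<open>q\<close>.\<close>
      obtain q where q: "q \<notin> {0, i - n}"
        using ex_new_if_finite[OF infinite_UNIV_int, of "{0, i - n}"] by auto
      have "n + q - i \<noteq> 0" using q by auto
      then have "of_int (n + q - i) \<noteq> (0 :: complex)" unfolding of_int_eq_0_iff .
      moreover have "of_int n + of_int q + a = of_int (n + q - i) + (of_int i + a)" by simp
      ultimately have "of_int n + of_int q + a \<noteq> 0" unfolding i by simp
      moreover have "(of_int n + of_int q + a) * Poly_Mapping.lookup v (II n) = 0"
        using arg_cong[OF v[of q], of "\<lambda>x. Poly_Mapping.lookup x (II (n + q))"] q b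
        by (simp add: lookup_w_bracket_basis del: mult_eq_0_iff)
          (simp add: algebra_simps neg_eq_iff_add_eq_0)
      ultimately show "Poly_Mapping.lookup v (II n) = Poly_Mapping.lookup 0 (II n)" by simp
    qed
    with nz show False by (simp add: v_def)
  qed
  show ?thesis using ne eq by (cases "i = j") auto
qed

section \<open>Products as finite sums over shifts\<close>

definition K :: "int set" where
  "K = {k. f k 0 \<noteq> 0 \<or> g k 0 \<noteq> 0 \<or> g k 1 \<noteq> 0}"

text \<open>Since \<open>f k\<close> is constant and \<open>g k\<close> affine, the two finitely
  supported vectors \<open>L_0 \<cdot> L_0\<close> and \<open>L_0 \<cdot> L_1\<close> detect every
  shift that occurs in any product.\<close>

lemma finite_K: "finite K"
proof -
  let ?S = "LI -` Poly_Mapping.keys (m (Lv 0) (Lv 0)) \<union> II -` Poly_Mapping.keys (m (Lv 0) (Lv 0))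
    \<union> (\<lambda>k. II (1 + k)) -` Poly_Mapping.keys (m (Lv 0) (Lv 1))"
  have "K \<subseteq> ?S" by (auto simp: K_def f_def g_def in_keys_iff)
  moreover have "finite ?S"
    by (intro finite_UnI finite_vimageI) (auto intro!: injI)
  ultimately show ?thesis by (rule finite_subset)
qed

lemma m_Lv_Lv_eq_sum:
  "m (Lv i) (Lv j) = (\<Sum>k\<in>K. w_scale (f k 0) (Lv (i + j + k)))
     + (\<Sum>k\<in>K. w_scale (g k (i + j)) (Iv (i + j + k)))"
proof -
  have "f k 0 = 0" "g k n = 0" if "k \<notin> K" for k n
    using that g_affine[of k n] by (simp_all add: K_def)
  then show ?thesis
    by (intro w_vec_eqI)
      (simp_all add: lookup_m_Lv_Lv lookup_add lookup_sum_basis finite_K f_const[of _ "i + j"]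
        diff_diff_eq)
qed

lemma m_Lv_Iv_eq_sum: "m (Lv i) (Iv j) = (\<Sum>k\<in>K. w_scale (f k 0) (Iv (i + j + k)))"
proof -
  have "f k 0 = 0" if "k \<notin> K" for k
    using that by (simp add: K_def)
  then show ?thesis
    by (intro w_vec_eqI)
      (simp_all add: lookup_m_Lv_Iv lookup_sum_basis finite_K \<alpha>_eq_0 \<epsilon>_eq diff_diff_eq)
qed

lemma f_or_g_nonzero:
  assumes "m x y \<noteq> 0"
  shows "\<exists>k. f k 0 \<noteq> 0 \<or> g k 0 \<noteq> 0 \<or> g k 1 \<noteq> 0"
proof (rule ccontr)
  assume "\<not> ?thesis"
  then have K: "K = {}" by (auto simp: K_def)
  have "m (Lv i) y = 0" for i
    by (rule w_linear_eq_0[OF m_linear]) (simp_all add: m_Lv_Lv_eq_sum m_Lv_Iv_eq_sum K)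
  moreover have "m (Iv i) y = 0" for i
  proof (rule w_linear_eq_0[OF m_linear])
    show "m (Iv i) (Lv j) = 0" for j
      unfolding m_comm[of "Iv i"] by (simp add: m_Lv_Iv_eq_sum K)
  qed (rule m_Iv_Iv)
  ultimately have "m y (Lv i) = 0" "m y (Iv i) = 0" for i
    using m_comm[of y] by simp_all
  then have "m y x = 0"
    by (rule w_linear_eq_0[OF m_linear])
  with assms show False using m_comm[of x y] by simp
qed

end

section \<open>Existence\<close>

lemma w_trilinear_eq_0:
  assumes lin: "\<And>y z. Vector_Spaces.linear w_scale w_scale (\<lambda>x. T x y z)"
      "\<And>x z. Vector_Spaces.linear w_scale w_scale (\<lambda>y. T x y z)"
      "\<And>x y. Vector_Spaces.linear w_scale w_scale (\<lambda>z. T x y z)"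
    and basis: "\<And>x y z. x \<in> range Lv \<union> range Iv \<Longrightarrow> y \<in> range Lv \<union> range Iv \<Longrightarrow>
      z \<in> range Lv \<union> range Iv \<Longrightarrow> T x y z = 0"
  shows "T x y z = 0"
proof -
  have 1: "T x y z = 0" if "x \<in> range Lv \<union> range Iv" "y \<in> range Lv \<union> range Iv" for x y z
    by (rule w_linear_eq_0[OF lin(3)]; rule basis) (use that in auto)
  have 2: "T x y z = 0" if "x \<in> range Lv \<union> range Iv" for x y z
    by (rule w_linear_eq_0[OF lin(2)]; rule 1) (use that in auto)
  show ?thesis
    by (rule w_linear_eq_0[OF lin(1)]; rule 2) auto
qed

section \<open>Model products supported on pairs of \<open>L\<close>'s\<close>

definition w_extend :: "(w_index \<Rightarrow> w_vec) \<Rightarrow> w_vec \<Rightarrow> w_vec" where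
  "w_extend B x = (\<Sum>p\<in>Poly_Mapping.keys x. w_scale (Poly_Mapping.lookup x p) (B p))"

lemma w_extend_superset:
  assumes "finite A" "Poly_Mapping.keys x \<subseteq> A"
  shows "w_extend B x = (\<Sum>p\<in>A. w_scale (Poly_Mapping.lookup x p) (B p))"
  unfolding w_extend_def
  by (rule sum.mono_neutral_left) (use assms in \<open>auto simp: in_keys_iff\<close>)

lemma w_extend_add: "w_extend B (x + y) = w_extend B x + w_extend B y"
proof -
  have "Poly_Mapping.keys (x + y) \<subseteq> Poly_Mapping.keys x \<union> Poly_Mapping.keys y"
    by (rule keys_add)
  then show ?thesis
    by (simp add: w_extend_superset[of "Poly_Mapping.keys x \<union> Poly_Mapping.keys y"]
        lookup_add w.scale_left_distrib sum.distrib)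
qed

lemma w_extend_scale: "w_extend B (w_scale c x) = w_scale c (w_extend B x)"
  using keys_w_scale[of c x]
  by (simp add: w_extend_superset[of "Poly_Mapping.keys x"] w.scale_sum_right)

lemma w_extend_basis [simp]:
  "w_extend B (Lv i) = B (LI i)" "w_extend B (Iv i) = B (II i)"
  by (simp_all add: w_extend_def Lv_def Iv_def)

fun w_basis_prod :: "(int \<Rightarrow> complex) \<Rightarrow> w_index \<Rightarrow> w_index \<Rightarrow> w_vec" where
  "w_basis_prod c (LI i) (LI j) = w_scale (c (i + j)) (Iv (i + j))"
| "w_basis_prod c _ _ = 0"

definition w_prod :: "(int \<Rightarrow> complex) \<Rightarrow> w_vec \<Rightarrow> w_vec \<Rightarrow> w_vec" where
  "w_prod c x y = w_extend (\<lambda>p. w_extend (w_basis_prod c p) y) x"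

lemma w_prod_basis [simp]:
  "w_prod c (Lv i) (Lv j) = w_scale (c (i + j)) (Iv (i + j))"
  "w_prod c (Lv i) (Iv j) = 0" "w_prod c (Iv i) (Lv j) = 0" "w_prod c (Iv i) (Iv j) = 0"
  by (simp_all add: w_prod_def)

lemma w_prod_bilinear:
  "w_prod c (x + y) z = w_prod c x z + w_prod c y z"
  "w_prod c x (y + z) = w_prod c x y + w_prod c x z"
  "w_prod c (w_scale r x) z = w_scale r (w_prod c x z)"
  "w_prod c x (w_scale r z) = w_scale r (w_prod c x z)"
  by (simp_all add: w_prod_def w_extend_add w_extend_scale)
    (simp_all add: w_extend_def w.scale_right_distrib sum.distrib w.scale_sum_right mult.left_commute)

lemma w_prod_zero [simp]: "w_prod c 0 y = 0" "w_prod c x 0 = 0"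
  by (simp_all add: w_prod_def w_extend_def)

text \<open>All products lie in the span of the \<open>I\<close>'s, which \<open>w_prod c\<close>
  annihilates, so both sides of associativity are zero. The defining identity is nontrivial only on
  three \<open>L\<close>'s, where it is the condition on \<open>c\<close>.\<close>

lemma w_prod_transposed_poisson:
  assumes c: "\<And>i j k. of_int (j - k) * c (i + j + k) =
    \<delta> * ((of_int (i + j) + b * of_int k + a) * c (i + j)
      - (of_int (i + k) + b * of_int j + a) * c (i + k))"
    and nz: "c n \<noteq> 0"
  shows "w_transposed_poisson a b \<delta> (w_prod c)"
proof -
  note bil = w_prod_bilinear w_bracket_add_left w_bracket_add_right w_bracket_scale_left
    w_bracket_scale_right
  have comm: "w_prod c x y = w_prod c y x" for x y
  proof -
    have "w_prod c (Lv i) y = w_prod c y (Lv i)" "w_prod c (Iv i) y = w_prod c y (Iv i)" for i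
      by (induction y rule: w_vec_induct) (simp_all add: bil add.commute)
    then show ?thesis
      by (induction x rule: w_vec_induct) (simp_all add: bil)
  qed
  have "w_prod c (w_prod c x y) z - w_prod c x (w_prod c y z) = 0" for x y z
    by (rule w_trilinear_eq_0[of "\<lambda>x y z. w_prod c (w_prod c x y) z - w_prod c x (w_prod c y z)"])
      (auto simp: Vector_Spaces.linear_iff vector_space_w_scale bil w.scale_right_diff_distrib)
  then have "comm_assoc_algebra w_scale (w_prod c)"
    using comm by (simp add: comm_assoc_algebra_def bilinear_product_def Vector_Spaces.linear_iff
        vector_space_w_scale bil)
  moreover have "w_prod c x (w_bracket a b y z)
      - w_scale \<delta> (w_bracket a b (w_prod c x y) z + w_bracket a b y (w_prod c x z)) = 0" for x y z
  proof (rule w_trilinear_eq_0[of "\<lambda>x y z. w_prod c x (w_bracket a b y z)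
      - w_scale \<delta> (w_bracket a b (w_prod c x y) z + w_bracket a b y (w_prod c x z))"])
    have "w_prod c (Lv i) (w_bracket a b (Lv j) (Lv k)) = w_scale \<delta>
        (w_bracket a b (w_prod c (Lv i) (Lv j)) (Lv k) + w_bracket a b (Lv j) (w_prod c (Lv i) (Lv k)))"
      for i j k
    proof -
      have "w_prod c (Lv i) (w_bracket a b (Lv j) (Lv k)) =
          w_scale (of_int (j - k) * c (i + j + k)) (Iv (i + j + k))"
        by (simp add: bil add.assoc)
      then show ?thesis
        unfolding c by (simp add: bil algebra_simps)
    qed
    then show "w_prod c x (w_bracket a b y z)
      - w_scale \<delta> (w_bracket a b (w_prod c x y) z + w_bracket a b y (w_prod c x z)) = 0"
      if "x \<in> range Lv \<union> range Iv" "y \<in> range Lv \<union> range Iv" "z \<in> range Lv \<union> range Iv" for x y z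
      using that by (auto simp: bil)
  qed (auto simp: Vector_Spaces.linear_iff vector_space_w_scale bil w.scale_right_diff_distrib
      w.scale_right_distrib mult.commute)
  moreover have "w_prod c (Lv 0) (Lv n) \<noteq> 0"
  proof
    assume "w_prod c (Lv 0) (Lv n) = 0"
    from arg_cong[OF this, of "\<lambda>v. Poly_Mapping.lookup v (II n)"] nz show False by simp
  qed
  moreover have "w_bracket a b (Lv 1) (Lv 0) \<noteq> 0"
  proof
    assume "w_bracket a b (Lv 1) (Lv 0) = 0"
    from arg_cong[OF this, of "\<lambda>v. Poly_Mapping.lookup v (LI 1)"] show False by simp
  qed
  ultimately show ?thesis
    unfolding nontrivial_transposed_poisson_def transposed_poisson_def
    using lie_algebra_w_bracket by (simp; blast)
qed

text \<open>For constant \<open>c\<close> the right side of the condition is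
  \<open>\<delta> * (1 - b)\<close> times the left. This also covers \<open>b = - 1\<close>.\<close>

lemma w_transposed_poisson_b_ne_1:
  assumes "b \<noteq> 1"
  shows "w_transposed_poisson a b (1 / (1 - b)) (w_prod (\<lambda>_. 1))"
  by (rule w_prod_transposed_poisson) (use assms in \<open>simp_all add: field_simps\<close>)

text \<open>For \<delta> = b = 1 the right side factors as
  \<open>(i + j + k + a) * (c (i + j) - c (i + k))\<close>, and \<open>c n = n + a\<close> turns the
  difference into \<open>j - k\<close>.\<close>

lemma w_transposed_poisson_b_eq_1: "w_transposed_poisson a 1 1 (w_prod (\<lambda>n. of_int n + a))"
proof (rule w_prod_transposed_poisson)
  show "of_int (if a = 0 then 1 else 0) + a \<noteq> 0" by simp
qed (simp add: algebra_simps)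

section \<open>Classification\<close>

lemma w_transposed_poisson_delta_nonzero:
  assumes "w_transposed_poisson a b \<delta> m" "b \<noteq> 1 \<or> \<delta> \<noteq> 0 \<or> a \<notin> \<int>"
  shows "w_tpa_nz a b \<delta> m"
proof -
  interpret w_tpa a b \<delta> m
    using assms(1) by unfold_locales (simp add: nontrivial_transposed_poisson_def)
  show ?thesis
    using assms m_eq_0_if_perfect
    by unfold_locales (auto simp: nontrivial_transposed_poisson_def)
qed

lemma w_transposed_poisson_form_b_generic:
  assumes tp: "w_transposed_poisson a b \<delta> m" and b: "b \<noteq> - 1" "b \<noteq> 1"
  shows "\<delta> = 1 / (1 - b) \<and> (\<exists>(K :: int set) \<mu>. finite K \<and>
    (\<forall>i j. m (Lv i) (Lv j) = (\<Sum>k\<in>K. w_scale (\<mu> k) (Iv (i + j + k)))) \<and>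
    (\<forall>i j. m (Lv i) (Iv j) = 0) \<and> (\<forall>i j. m (Iv i) (Iv j) = 0))"
proof -
  interpret w_tpa_nz a b \<delta> m
    using w_transposed_poisson_delta_nonzero tp b by blast
  have f: "f k 0 = 0" for k using f_nonzero_b b by blast
  have g: "g k 1 = g k 0" for k using g_slope(2) b by blast
  have g0: "g k n = g k 0" for k n using g_affine[of k n] by (simp add: g)
  obtain x y where xy: "m x y \<noteq> 0"
    using tp unfolding nontrivial_transposed_poisson_def by blast
  obtain k where "g k 0 \<noteq> 0"
    using f_or_g_nonzero[OF xy] by (auto simp: f g)
  then have "\<delta> * (1 - b) = 1" by (rule g_constant_nonzero[OF g])
  with b have "\<delta> = 1 / (1 - b)" by (simp add: field_simps)
  moreover have "m (Lv i) (Lv j) = (\<Sum>k\<in>K. w_scale (g k 0) (Iv (i + j + k)))" for i j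
    by (simp add: m_Lv_Lv_eq_sum f g0[of _ "i + j"])
  ultimately show ?thesis
    using finite_K m_Lv_Iv_eq_0[OF b(1)] m_Iv_Iv by (intro conjI exI allI)
qed

text \<open>The coefficient \<open>\<mu> k\<close> is the slope of \<open>g k\<close>. The
  hypothesis on \<delta> and \<open>a\<close> leaves out \<delta> = 0 with integral
  \<open>a\<close>, where no bracket has an \<open>I_(-a)\<close> component.\<close>

lemma w_transposed_poisson_form_b_eq_1:
  assumes tp: "w_transposed_poisson a b \<delta> m" and nz: "\<delta> \<noteq> 0 \<or> a \<notin> \<int>" and b: "b = 1"
  shows "\<delta> = 1 \<and> (\<exists>(K :: int set) \<mu>. finite K \<and>
    (\<forall>i j. m (Lv i) (Lv j) =
      (\<Sum>k\<in>K. w_scale (\<mu> k * (of_int (i + j + k) + a)) (Iv (i + j + k)))) \<and>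
    (\<forall>i j. m (Lv i) (Iv j) = 0) \<and> (\<forall>i j. m (Iv i) (Iv j) = 0))"
proof -
  interpret w_tpa_nz a b \<delta> m
    using w_transposed_poisson_delta_nonzero tp nz by blast
  have f: "f k 0 = 0" for k using f_nonzero_b[of k 0] b by auto
  \<comment> \<open>A zero slope gives \<open>g k 0 = 0\<close>, because
    \<open>\<delta> * (1 - b) = 0\<close> for \<open>b = 1\<close>.\<close>
  have g0: "g k 0 = (of_int k + a) * (g k 1 - g k 0)" for k
    using g_slope(3)[of k] g_constant_nonzero[of k] b by (cases "g k 1 = g k 0") auto
  have g: "g k n = (g k 1 - g k 0) * (of_int (n + k) + a)" for k n
    by (subst g_affine, subst g0) (simp add: algebra_simps)
  obtain x y where xy: "m x y \<noteq> 0"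
    using tp unfolding nontrivial_transposed_poisson_def by blast
  obtain k where "g k 0 \<noteq> 0 \<or> g k 1 \<noteq> 0"
    using f_or_g_nonzero[OF xy] by (auto simp: f)
  then have "g k 1 \<noteq> g k 0" using g0[of k] by auto
  then have "\<delta> = 1" by (rule g_slope(1))
  moreover have "m (Lv i) (Lv j) =
      (\<Sum>k\<in>K. w_scale ((g k 1 - g k 0) * (of_int (i + j + k) + a)) (Iv (i + j + k)))" for i j
    unfolding m_Lv_Lv_eq_sum g[of _ "i + j"] by (simp add: f)
  moreover have "m (Lv i) (Iv j) = 0" for i j by (rule m_Lv_Iv_eq_0) (simp add: b)
  ultimately show ?thesis
    using finite_K m_Iv_Iv by (intro conjI exI allI)
qed

lemma w_transposed_poisson_form_b_eq_minus_1:
  assumes tp: "w_transposed_poisson a b \<delta> m" and b: "b = - 1"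
  shows "\<delta> = 1 / 2 \<and> (\<exists>(K :: int set) \<nu> \<mu>. finite K \<and>
    (\<forall>i j. m (Lv i) (Lv j) =
      (\<Sum>k\<in>K. w_scale (\<nu> k) (Lv (i + j + k))) + (\<Sum>k\<in>K. w_scale (\<mu> k) (Iv (i + j + k)))) \<and>
    (\<forall>i j. m (Lv i) (Iv j) = (\<Sum>k\<in>K. w_scale (\<nu> k) (Iv (i + j + k)))) \<and>
    (\<forall>i j. m (Iv i) (Iv j) = 0))"
proof -
  interpret w_tpa_nz a b \<delta> m
    using w_transposed_poisson_delta_nonzero[OF tp] b by simp
  have g: "g k 1 = g k 0" for k using g_slope(2)[of k] b by auto
  have g0: "g k n = g k 0" for k n using g_affine[of k n] by (simp add: g)
  obtain x y where xy: "m x y \<noteq> 0"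
    using tp unfolding nontrivial_transposed_poisson_def by blast
  obtain k where "f k 0 \<noteq> 0 \<or> g k 0 \<noteq> 0"
    using f_or_g_nonzero[OF xy] by (auto simp: g)
  \<comment> \<open>Both alternatives agree: \<open>f \<noteq> 0\<close> gives 1/2 directly, and
    \<open>\<delta> * (1 - b) = 1\<close> reads \<open>2 * \<delta> = 1\<close>.\<close>
  then have "\<delta> = 1 / 2"
    using f_nonzero[of k 0] g_constant_nonzero[OF g, of k] b by (auto simp: field_simps)
  moreover have "m (Lv i) (Lv j) = (\<Sum>k\<in>K. w_scale (f k 0) (Lv (i + j + k)))
      + (\<Sum>k\<in>K. w_scale (g k 0) (Iv (i + j + k)))" for i j
    by (simp add: m_Lv_Lv_eq_sum g0[of _ "i + j"])
  ultimately show ?thesis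
    using finite_K m_Lv_Iv_eq_sum m_Iv_Iv by (intro conjI exI allI)
qed

theorem corollary24:
  fixes a b :: complex
  shows
    "(b \<notin> {-1, 1} \<longrightarrow>
       (\<exists>\<delta> m. w_transposed_poisson a b \<delta> m) \<and>
       (\<forall>\<delta> m. w_transposed_poisson a b \<delta> m \<longrightarrow>
          \<delta> = 1 / (1 - b) \<and>
          (\<exists>(K :: int set) \<mu>. finite K \<and>
             (\<forall>i j. m (Lv i) (Lv j) = (\<Sum>k\<in>K. w_scale (\<mu> k) (Iv (i + j + k)))) \<and>
             (\<forall>i j. m (Lv i) (Iv j) = 0) \<and>
             (\<forall>i j. m (Iv i) (Iv j) = 0)))) \<and>
     (b = 1 \<longrightarrow>
       (\<exists>\<delta> m. w_transposed_poisson a b \<delta> m \<and>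
          \<delta> = 1 \<and>
          (\<exists>(K :: int set) \<mu>. finite K \<and>
             (\<forall>i j. m (Lv i) (Lv j) =
                (\<Sum>k\<in>K. w_scale (of_int (i + j + k) + \<mu> k) (Iv (i + j + k)))) \<and>
             (\<forall>i j. m (Lv i) (Iv j) = 0) \<and>
             (\<forall>i j. m (Iv i) (Iv j) = 0))) \<and>
       (\<forall>\<delta> m. w_transposed_poisson a b \<delta> m \<and> (\<delta> \<noteq> 0 \<or> a \<notin> \<int>) \<longrightarrow>
          \<delta> = 1 \<and>
          (\<exists>(K :: int set) \<mu>. finite K \<and>
             (\<forall>i j. m (Lv i) (Lv j) =
                (\<Sum>k\<in>K. w_scale (\<mu> k * (of_int (i + j + k) + a)) (Iv (i + j + k)))) \<and>
             (\<forall>i j. m (Lv i) (Iv j) = 0) \<and>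
             (\<forall>i j. m (Iv i) (Iv j) = 0)))) \<and>
     (b = -1 \<longrightarrow>
       (\<exists>\<delta> m. w_transposed_poisson a b \<delta> m) \<and>
       (\<forall>\<delta> m. w_transposed_poisson a b \<delta> m \<longrightarrow>
          \<delta> = 1 / 2 \<and>
          (\<exists>(K :: int set) \<nu> \<mu>. finite K \<and>
             (\<forall>i j. m (Lv i) (Lv j) =
                (\<Sum>k\<in>K. w_scale (\<nu> k) (Lv (i + j + k))) +
                (\<Sum>k\<in>K. w_scale (\<mu> k) (Iv (i + j + k)))) \<and>
             (\<forall>i j. m (Lv i) (Iv j) = (\<Sum>k\<in>K. w_scale (\<nu> k) (Iv (i + j + k)))) \<and>
             (\<forall>i j. m (Iv i) (Iv j) = 0))))"
proof (intro conjI impI)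
  show "\<exists>\<delta> m. w_transposed_poisson a b \<delta> m" if "b \<notin> {- 1, 1}"
    using w_transposed_poisson_b_ne_1 that by blast
  show "\<exists>\<delta> m. w_transposed_poisson a b \<delta> m" if "b = - 1"
    using w_transposed_poisson_b_ne_1[of b a] that by auto
  show "\<exists>\<delta> m. w_transposed_poisson a b \<delta> m \<and>
          \<delta> = 1 \<and>
          (\<exists>(K :: int set) \<mu>. finite K \<and>
             (\<forall>i j. m (Lv i) (Lv j) =
                (\<Sum>k\<in>K. w_scale (of_int (i + j + k) + \<mu> k) (Iv (i + j + k)))) \<and>
             (\<forall>i j. m (Lv i) (Iv j) = 0) \<and>
             (\<forall>i j. m (Iv i) (Iv j) = 0))" if "b = 1"
    using w_transposed_poisson_b_eq_1[of a] that
    \<comment> \<open>A single shift \<open>k = 0\<close> with \<open>\<mu> 0 = a\<close> reproduces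
      the coefficient \<open>i + j + a\<close> of the model product.\<close>
    by (intro exI[of _ 1] exI[of _ "w_prod (\<lambda>n. of_int n + a)"] exI[of _ "{0}"]
        exI[of _ "\<lambda>_. a"] conjI) simp_all
qed (intro allI impI,
    ((rule w_transposed_poisson_form_b_generic; simp) |
     (rule w_transposed_poisson_form_b_eq_1; simp) |
     (rule w_transposed_poisson_form_b_eq_minus_1; simp)))+

end
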